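(* Let $G$ be a group, $V$ a set, and suppose $\varphi(x,y)$ is a left-invariant stable relation on $G\times V$. Let $\mathcal{B}_\varphi$ be the Boolean algebra of subsets of $G$ generated by the sets $\varphi(G,b)=\{a\in G:\varphi(a,b)\}$ for $b\in V$. Then $\mathcal{B}_\varphi$ is a left-invariant Boolean algebra all of whose members are stable in $G$, and $G^0_{\mathcal{B}_\varphi}$ has finite index in $G$ (equivalently, $\mathcal{B}_\varphi$ contains a smallest finite-index subgroup of $G$).
   Context: A relation $\varphi(x,y)$ on $G\times V$ is stable if there do not exist an infinite linearly ordered set $I$ and sequences $(a_i)_{i\in I}$ in $G$, $(b_i)_{i\in I}$ in $V$ with $\varphi(a_i,b_j)$ iff $i\le j$. It is left-invariant if for every $g\in G$ and $b\in V$ there is $c\in V$ with $g\varphi(G,b)=\varphi(G,c)$. A set $A\subseteq G$ is stable in $G$ if the relation $xy\in A$ on $G\times G$ is stable. A Boolean algebra $\mathcal{B}\subseteq\mathcal{P}(G)$ is left-invariant if $gA\in\mathcal{B}$ for $g\in G$, $A\in\mathcal{B}$. $G^0_{\mathcal{B}}$ denotes the intersection of all finite-index subgroups of $G$ that belong to $\mathcal{B}$. *)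

theory Defs
  imports "HOL-Algebra.Coset" "HOL-Analysis.Sigma_Algebra"
begin

text \<open>The index set ranges over subsets of the type of the first coordinate. This is no loss of
  generality: in any witness of instability the sequence \<open>a\<close> is injective, so the index order can be
  transported to the range of \<open>a\<close>. The lemma \<open>stable_relD\<close> below gives the definition for
  index sets of an arbitrary type.\<close>

definition stable_rel :: "'a set \<Rightarrow> 'b set \<Rightarrow> ('a \<Rightarrow> 'b \<Rightarrow> bool) \<Rightarrow> bool" where
  "stable_rel X Y \<phi> \<longleftrightarrow>
    \<not> (\<exists>(I :: 'a set) r a b. infinite I \<and> linear_order_on I r \<and> a \<in> I \<rightarrow> X \<and> b \<in> I \<rightarrow> Y \<and>
        (\<forall>i\<in>I. \<forall>j\<in>I. \<phi> (a i) (b j) \<longleftrightarrow> (i, j) \<in> r))"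

lemma stable_relD:
  fixes I :: "'i set"
  assumes st: "stable_rel X Y \<phi>"
    and inf: "infinite I" and lin: "linear_order_on I r"
    and a: "a \<in> I \<rightarrow> X" and b: "b \<in> I \<rightarrow> Y"
    and iff: "\<And>i j. i \<in> I \<Longrightarrow> j \<in> I \<Longrightarrow> \<phi> (a i) (b j) \<longleftrightarrow> (i, j) \<in> r"
  shows False
proof -
  have rI: "r \<subseteq> I \<times> I" and refl: "\<And>i. i \<in> I \<Longrightarrow> (i, i) \<in> r" and tr: "trans r"
    and anti: "antisym r" and tot: "total_on I r"
    using lin by (auto simp: order_on_defs refl_on_def)
  have inj: "inj_on a I"
  proof (rule inj_onI)
    fix i j assume ij: "i \<in> I" "j \<in> I" "a i = a j"
    then have "(i, j) \<in> r" "(j, i) \<in> r" using iff refl by metis+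
    then show "i = j" using anti by (auto dest: antisymD)
  qed
  define J where "J = a ` I"
  define s where "s = map_prod a a ` r"
  define c where "c = inv_into I a"
  have c: "c x \<in> I" "a (c x) = x" if "x \<in> J" for x
    using that by (auto simp: c_def J_def inv_into_into f_inv_into_f)
  have ca: "c (a i) = i" if "i \<in> I" for i
    using that inj by (simp add: c_def)
  have s: "(x, y) \<in> s \<longleftrightarrow> x \<in> J \<and> y \<in> J \<and> (c x, c y) \<in> r" for x y
  proof
    assume "(x, y) \<in> s"
    then obtain i j where "(i, j) \<in> r" "x = a i" "y = a j" by (auto simp: s_def)
    then show "x \<in> J \<and> y \<in> J \<and> (c x, c y) \<in> r" using rI ca by (auto simp: J_def)
  next
    assume "x \<in> J \<and> y \<in> J \<and> (c x, c y) \<in> r"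
    then have "map_prod a a (c x, c y) \<in> s" "a (c x) = x" "a (c y) = y"
      using c by (auto simp: s_def simp del: map_prod_simp)
    then show "(x, y) \<in> s" by simp
  qed
  have "linear_order_on J s"
    unfolding order_on_defs
  proof (intro conjI)
    show "s \<subseteq> J \<times> J" using s by auto
    show "refl_on J s" using s refl c by (auto simp: refl_on_def)
    show "trans s" using s tr by (meson transD transI)
    show "antisym s" using s anti c by (metis antisymD antisymI)
    show "total_on J s" using s tot c unfolding total_on_def by metis
  qed
  moreover have "infinite J" using inf inj by (simp add: J_def finite_image_iff)
  moreover have "a \<circ> c \<in> J \<rightarrow> X" "b \<circ> c \<in> J \<rightarrow> Y" using a b c(1) by auto
  moreover have "\<forall>x\<in>J. \<forall>y\<in>J. \<phi> ((a \<circ> c) x) ((b \<circ> c) y) \<longleftrightarrow> (x, y) \<in> s"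
    using s iff c(1) by simp
  ultimately show False using st unfolding stable_rel_def by blast
qed

definition fiber :: "('a, 'm) monoid_scheme \<Rightarrow> ('a \<Rightarrow> 'b \<Rightarrow> bool) \<Rightarrow> 'b \<Rightarrow> 'a set" where
  "fiber G \<phi> b = {a \<in> carrier G. \<phi> a b}"

definition left_invariant_rel ::
    "('a, 'm) monoid_scheme \<Rightarrow> 'b set \<Rightarrow> ('a \<Rightarrow> 'b \<Rightarrow> bool) \<Rightarrow> bool" where
  "left_invariant_rel G V \<phi> \<longleftrightarrow>
    (\<forall>g\<in>carrier G. \<forall>b\<in>V. \<exists>c\<in>V. g <#\<^bsub>G\<^esub> fiber G \<phi> b = fiber G \<phi> c)"

definition stable_in :: "('a, 'm) monoid_scheme \<Rightarrow> 'a set \<Rightarrow> bool" where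
  "stable_in G A \<longleftrightarrow> stable_rel (carrier G) (carrier G) (\<lambda>x y. x \<otimes>\<^bsub>G\<^esub> y \<in> A)"

definition left_invariant_algebra :: "('a, 'm) monoid_scheme \<Rightarrow> 'a set set \<Rightarrow> bool" where
  "left_invariant_algebra G \<B> \<longleftrightarrow>
    algebra (carrier G) \<B> \<and> (\<forall>g\<in>carrier G. \<forall>A\<in>\<B>. g <#\<^bsub>G\<^esub> A \<in> \<B>)"

text \<open>The smallest Boolean algebra of subsets of \<open>carrier G\<close> containing the fibers over \<open>V\<close>.\<close>

definition fiber_algebra ::
    "('a, 'm) monoid_scheme \<Rightarrow> 'b set \<Rightarrow> ('a \<Rightarrow> 'b \<Rightarrow> bool) \<Rightarrow> 'a set set" where
  "fiber_algebra G V \<phi> = algebra (carrier G) hull (fiber G \<phi> ` V)"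

definition finite_index_subgroup :: "'a set \<Rightarrow> ('a, 'm) monoid_scheme \<Rightarrow> bool" where
  "finite_index_subgroup H G \<longleftrightarrow> subgroup H G \<and> finite (rcosets\<^bsub>G\<^esub> H)"

definition G_zero :: "('a, 'm) monoid_scheme \<Rightarrow> 'a set set \<Rightarrow> 'a set" where
  "G_zero G \<B> = \<Inter> {H \<in> \<B>. finite_index_subgroup H G}"

end

(* Proof idea. By Ramsey's theorem a relation is stable iff every pair of sequences has a common
   subsequence along which it is constant off the diagonal; hence stability passes to Boolean
   combinations. Let J be a maximal proper left-invariant ideal of subsets of G. By stability some
   set A outside J is not split modulo J by any fiber, hence by no member of the Boolean algebra,
   and by maximality finitely many translates of A, say k, cover G modulo J. Each translate is
   contained modulo J in a single left coset of a finite-index subgroup H of the algebra, and no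
   coset lies in J, so H has index at most k. A finite-index subgroup of maximal index in the
   algebra is contained in every other one. *)

theory Submission
  imports Defs "HOL-Library.Ramsey"
begin

section \<open>Stability of relations\<close>

text \<open>An unordered pair of indices is coloured by the two truth values of \<open>P\<close>,
  one for each order of the pair. An infinite homogeneous set, enumerated increasingly, is the
  subsequence.\<close>

lemma ramsey_subseq:
  fixes P :: "nat \<Rightarrow> nat \<Rightarrow> bool"
  shows "\<exists>f d e. strict_mono (f :: nat \<Rightarrow> nat) \<and>
    (\<forall>i j. i < j \<longrightarrow> P (f i) (f j) = d \<and> P (f j) (f i) = e)"
proof -
  \<comment> \<open>The two truth values are packed as binary digits, so the common colour
    \<open>t\<close> determines both of them.\<close>
  define c where
    "c S = (if P (Min S) (Max S) then 1 else 0) + (if P (Max S) (Min S) then 2 else (0::nat))" for S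
  have "c S < 4" for S
    by (cases "P (Min S) (Max S)"; cases "P (Max S) (Min S)"; simp add: c_def)
  then have "\<exists>Y t. Y \<subseteq> UNIV \<and> infinite Y \<and> t < 4 \<and> (\<forall>x\<in>Y. \<forall>y\<in>Y. x \<noteq> y \<longrightarrow> c {x, y} = t)"
    by (intro Ramsey2) auto
  then obtain Y t where Y: "infinite Y" "\<forall>x\<in>Y. \<forall>y\<in>Y. x \<noteq> y \<longrightarrow> c {x, y} = t"
    by (elim exE conjE)
  define f where "f = enumerate Y"
  have f: "strict_mono f" using Y(1) by (simp add: f_def strict_mono_enumerate)
  have fY: "f i \<in> Y" for i using Y(1) by (simp add: f_def enumerate_in_set)
  have lt: "f i < f j" if "i < j" for i j using f that by (simp add: strict_mono_less)
  have ct: "(if P (f i) (f j) then 1 else 0) + (if P (f j) (f i) then 2 else (0::nat)) = t"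
    if "i < j" for i j
  proof -
    have "c {f i, f j} = t" using Y(2) fY lt[OF that] by (metis less_irrefl)
    moreover have "Min {f i, f j} = f i" "Max {f i, f j} = f j" using lt[OF that] by auto
    ultimately show ?thesis by (simp add: c_def)
  qed
  have "\<forall>i j. i < j \<longrightarrow> P (f i) (f j) = (t = 1 \<or> t = 3) \<and> P (f j) (f i) = (t = 2 \<or> t = 3)"
  proof (intro allI impI)
    fix i j :: nat assume "i < j"
    then show "P (f i) (f j) = (t = 1 \<or> t = 3) \<and> P (f j) (f i) = (t = 2 \<or> t = 3)"
      using ct[of i j] by (cases "P (f i) (f j)"; cases "P (f j) (f i)"; simp)
  qed
  with f show ?thesis by (intro exI conjI)
qed

text \<open>Ramsey makes the array constant above the diagonal and constant below it. Different
  constants would give an infinite half graph, so they agree.\<close>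

lemma stable_rel_subseq:
  assumes st: "stable_rel X Y \<phi>" and q: "range q \<subseteq> X" and b: "range b \<subseteq> Y"
  shows "\<exists>f e. strict_mono (f :: nat \<Rightarrow> nat) \<and> (\<forall>i j. i \<noteq> j \<longrightarrow> \<phi> (q (f i)) (b (f j)) = e)"
proof -
  obtain f d e where f: "strict_mono (f :: nat \<Rightarrow> nat)"
    and de: "\<forall>i j. i < j \<longrightarrow> \<phi> (q (f i)) (b (f j)) = d \<and> \<phi> (q (f j)) (b (f i)) = e"
    using ramsey_subseq[of "\<lambda>i j. \<phi> (q i) (b j)"] by (elim exE conjE)
  have d: "\<phi> (q (f i)) (b (f j)) = d" and e: "\<phi> (q (f j)) (b (f i)) = e" if "i < j" for i j
    using de that by auto
  have "d = e"
  proof (rule ccontr)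
    assume "d \<noteq> e"
    then consider "d" "\<not> e" | "\<not> d" "e" by blast
    then show False
    proof cases
      \<comment> \<open>Even indices for \<open>q\<close> and odd ones for \<open>b\<close> avoid
        the unknown diagonal: \<open>2 * i < 2 * j + 1\<close> holds exactly when
        \<open>i \<le> j\<close>.\<close>
      case 1
      show False
      proof (rule stable_relD[OF st])
        show "infinite (UNIV :: nat set)" by simp
        show "linear_order_on UNIV {(i::nat, j). i \<le> j}"
          by (auto simp: order_on_defs refl_on_def total_on_def trans_def antisym_def)
        show "(\<lambda>i. q (f (2 * i))) \<in> UNIV \<rightarrow> X" "(\<lambda>j. b (f (2 * j + 1))) \<in> UNIV \<rightarrow> Y"
          using q b by blast+
        show "\<phi> (q (f (2 * i))) (b (f (2 * j + 1))) \<longleftrightarrow> (i, j) \<in> {(i, j). i \<le> j}" for i j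
          using d[of "2 * i" "2 * j + 1"] e[of "2 * j + 1" "2 * i"] 1 by (cases "i \<le> j") auto
      qed
    next
      \<comment> \<open>Here the parities are exchanged and the half graph is ordered by the reverse
        of the usual order.\<close>
      case 2
      show False
      proof (rule stable_relD[OF st])
        show "infinite (UNIV :: nat set)" by simp
        show "linear_order_on UNIV {(i::nat, j). j \<le> i}"
          by (auto simp: order_on_defs refl_on_def total_on_def trans_def antisym_def)
        show "(\<lambda>i. q (f (2 * i + 1))) \<in> UNIV \<rightarrow> X" "(\<lambda>j. b (f (2 * j))) \<in> UNIV \<rightarrow> Y"
          using q b by blast+
        show "\<phi> (q (f (2 * i + 1))) (b (f (2 * j))) \<longleftrightarrow> (i, j) \<in> {(i, j). j \<le> i}" for i j
          using d[of "2 * i + 1" "2 * j"] e[of "2 * j" "2 * i + 1"] 2 by (cases "j \<le> i") auto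
      qed
    qed
  qed
  then have "\<phi> (q (f i)) (b (f j)) = e" if "i \<noteq> j" for i j
    using d[of i j] e[of j i] that by (cases i j rule: linorder_cases) auto
  with f show ?thesis by (intro exI[of _ f] exI[of _ e] conjI allI impI; simp)
qed

text \<open>This criterion mentions neither orders nor half graphs, so closure properties follow by
  thinning sequences. For the converse, a monotone sequence in the index order has different values
  on the two sides of the diagonal, and thinning cannot remove that.\<close>

lemma stable_rel_iff_subseq:
  fixes X :: "'a set"
  shows "stable_rel X Y \<phi> \<longleftrightarrow> (\<forall>q b. range q \<subseteq> X \<longrightarrow> range b \<subseteq> Y \<longrightarrow>
    (\<exists>f e. strict_mono (f :: nat \<Rightarrow> nat) \<and> (\<forall>i j. i \<noteq> j \<longrightarrow> \<phi> (q (f i)) (b (f j)) = e)))"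
  (is "_ \<longleftrightarrow> ?R")
proof
  assume "stable_rel X Y \<phi>"
  then show ?R by (intro allI impI stable_rel_subseq)
next
  assume R: ?R
  show "stable_rel X Y \<phi>"
    unfolding stable_rel_def
  proof (intro notI, elim exE conjE)
    fix I :: "'a set" and r a b
    assume I: "infinite I" "linear_order_on I r" "a \<in> I \<rightarrow> X" "b \<in> I \<rightarrow> Y"
      and iff: "\<forall>i\<in>I. \<forall>j\<in>I. \<phi> (a i) (b j) \<longleftrightarrow> (i, j) \<in> r"
    obtain x where x: "inj (x :: nat \<Rightarrow> 'a)" "range x \<subseteq> I"
      using I(1) unfolding infinite_iff_countable_subset by (elim exE conjE)
    have xI: "x n \<in> I" for n using x(2) by auto
    obtain f d e where f: "strict_mono (f :: nat \<Rightarrow> nat)"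
      and de: "\<forall>i j. i < j \<longrightarrow> ((x (f i), x (f j)) \<in> r) = d \<and> ((x (f j), x (f i)) \<in> r) = e"
      using ramsey_subseq[of "\<lambda>i j. (x i, x j) \<in> r"] by (elim exE conjE)
    have "f 0 < f 1" using f by (simp add: strict_mono_less)
    then have "x (f 0) \<noteq> x (f 1)" using x(1) by (auto dest: injD)
    moreover have "((x (f 0), x (f 1)) \<in> r) = d" "((x (f 1), x (f 0)) \<in> r) = e"
      using de by auto
    moreover have "antisym r" "total_on I r" using I(2) by (auto simp: order_on_defs)
    \<comment> \<open>Totality and antisymmetry put two distinct elements in \<open>r\<close> in
      exactly one of the two orders.\<close>
    ultimately have "d \<noteq> e"
      using xI[of "f 0"] xI[of "f 1"] by (auto simp: total_on_def dest: antisymD)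
    have "range (a \<circ> x \<circ> f) \<subseteq> X" "range (b \<circ> x \<circ> f) \<subseteq> Y"
      using I(3,4) xI by auto
    from R[rule_format, OF this] obtain g c where g: "strict_mono (g :: nat \<Rightarrow> nat)"
      and c: "\<forall>i j. i \<noteq> j \<longrightarrow> \<phi> ((a \<circ> x \<circ> f) (g i)) ((b \<circ> x \<circ> f) (g j)) = c"
      by (elim exE conjE)
    have "g 0 < g 1" using g by (simp add: strict_mono_less)
    with de have "((x (f (g 0)), x (f (g 1))) \<in> r) = d" "((x (f (g 1)), x (f (g 0))) \<in> r) = e"
      by blast+
    then have "\<phi> (a (x (f (g 0)))) (b (x (f (g 1)))) = d" "\<phi> (a (x (f (g 1)))) (b (x (f (g 0)))) = e"
      using iff xI by auto
    then show False using c[rule_format, of 0 1] c[rule_format, of 1 0] \<open>d \<noteq> e\<close> by simp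
  qed
qed

lemma stable_rel_swap:
  fixes X :: "'a set" and Y :: "'b set"
  assumes "stable_rel X Y \<phi>"
  shows "stable_rel Y X (\<lambda>y x. \<phi> x y)"
  unfolding stable_rel_iff_subseq
proof (intro allI impI)
  fix q :: "nat \<Rightarrow> 'b" and b :: "nat \<Rightarrow> 'a"
  assume "range q \<subseteq> Y" "range b \<subseteq> X"
  from stable_rel_subseq[OF assms this(2) this(1)] obtain f e where
    "strict_mono (f :: nat \<Rightarrow> nat)" and e: "\<forall>i j. i \<noteq> j \<longrightarrow> \<phi> (b (f i)) (q (f j)) = e"
    by (elim exE conjE)
  then show "\<exists>f e. strict_mono (f :: nat \<Rightarrow> nat) \<and> (\<forall>i j. i \<noteq> j \<longrightarrow> \<phi> (b (f j)) (q (f i)) = e)"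
    by (intro exI[of _ f] exI[of _ e]) auto
qed

lemma stable_rel_reparam:
  fixes X' :: "'c set" and Y' :: "'d set"
  assumes st: "stable_rel X Y \<phi>" and u: "u \<in> X' \<rightarrow> X" and v: "v \<in> Y' \<rightarrow> Y"
    and eq: "\<And>x y. x \<in> X' \<Longrightarrow> y \<in> Y' \<Longrightarrow> \<psi> x y \<longleftrightarrow> \<phi> (u x) (v y)"
  shows "stable_rel X' Y' \<psi>"
  unfolding stable_rel_iff_subseq
proof (intro allI impI)
  fix q :: "nat \<Rightarrow> 'c" and b :: "nat \<Rightarrow> 'd"
  assume qb: "range q \<subseteq> X'" "range b \<subseteq> Y'"
  then have "range (u \<circ> q) \<subseteq> X" "range (v \<circ> b) \<subseteq> Y" using u v by auto
  from stable_rel_subseq[OF st this] obtain f e where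
    "strict_mono (f :: nat \<Rightarrow> nat)" "\<forall>i j. i \<noteq> j \<longrightarrow> \<phi> (u (q (f i))) (v (b (f j))) = e"
    unfolding comp_def by (elim exE conjE)
  then show "\<exists>f e. strict_mono (f :: nat \<Rightarrow> nat) \<and> (\<forall>i j. i \<noteq> j \<longrightarrow> \<psi> (q (f i)) (b (f j)) = e)"
    using qb eq by (intro exI[of _ f] exI[of _ e]) (simp add: range_subsetD)
qed

text \<open>Thinning once for each relation makes both constant off the diagonal, hence also any
  Boolean function \<open>h\<close> of them.\<close>

lemma stable_rel_combine:
  fixes X :: "'a set" and Y :: "'b set"
  assumes st: "stable_rel X Y \<phi>" "stable_rel X Y \<psi>"
  shows "stable_rel X Y (\<lambda>x y. h (\<phi> x y) (\<psi> x y))"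
  unfolding stable_rel_iff_subseq
proof (intro allI impI)
  fix q :: "nat \<Rightarrow> 'a" and b :: "nat \<Rightarrow> 'b"
  assume qb: "range q \<subseteq> X" "range b \<subseteq> Y"
  obtain f e where f: "strict_mono (f :: nat \<Rightarrow> nat)"
    and e: "\<forall>i j. i \<noteq> j \<longrightarrow> \<phi> (q (f i)) (b (f j)) = e"
    using stable_rel_subseq[OF st(1) qb] by (elim exE conjE)
  have "range (q \<circ> f) \<subseteq> X" "range (b \<circ> f) \<subseteq> Y" using qb by auto
  from stable_rel_subseq[OF st(2) this] obtain g c where g: "strict_mono (g :: nat \<Rightarrow> nat)"
    and c: "\<forall>i j. i \<noteq> j \<longrightarrow> \<psi> (q (f (g i))) (b (f (g j))) = c"
    unfolding comp_def by (elim exE conjE)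
  have "strict_mono (f \<circ> g)" using f g by (simp add: strict_mono_o)
  moreover have "g i \<noteq> g j" if "i \<noteq> j" for i j using g that by (simp add: strict_mono_eq)
  ultimately show "\<exists>f e'. strict_mono (f :: nat \<Rightarrow> nat) \<and>
      (\<forall>i j. i \<noteq> j \<longrightarrow> h (\<phi> (q (f i)) (b (f j))) (\<psi> (q (f i)) (b (f j))) = e')"
    using e c by (intro exI[of _ "f \<circ> g"] exI[of _ "h e c"]) simp
qed

section \<open>The algebra generated by the fibers\<close>

lemma algebra_fiber_algebra: "algebra (carrier G) (fiber_algebra G V \<phi>)"
proof -
  have "algebra (carrier G) (Pow (carrier G))" by (auto simp: algebra_iff_Un)
  moreover have "fiber G \<phi> ` V \<subseteq> Pow (carrier G)" by (auto simp: fiber_def)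
  ultimately have "fiber_algebra G V \<phi> \<subseteq> Pow (carrier G)"
    unfolding fiber_algebra_def by (rule hull_minimal[rotated])
  moreover have "{} \<in> fiber_algebra G V \<phi>"
    and "\<And>A. A \<in> fiber_algebra G V \<phi> \<Longrightarrow> carrier G - A \<in> fiber_algebra G V \<phi>"
    and "\<And>A B. \<lbrakk>A \<in> fiber_algebra G V \<phi>; B \<in> fiber_algebra G V \<phi>\<rbrakk> \<Longrightarrow> A \<union> B \<in> fiber_algebra G V \<phi>"
    unfolding fiber_algebra_def hull_def by (auto simp: algebra_iff_Un)
  ultimately show ?thesis by (auto simp: algebra_iff_Un)
qed

lemma fiber_in_fiber_algebra: "b \<in> V \<Longrightarrow> fiber G \<phi> b \<in> fiber_algebra G V \<phi>"
  unfolding fiber_algebra_def by (meson hull_subset imageI subsetD)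

text \<open>The members satisfying \<open>P\<close> form an algebra containing the fibers, so
  minimality of the hull applies.\<close>

lemma fiber_algebra_induct [consumes 1, case_names fiber empty compl Un]:
  assumes A: "A \<in> fiber_algebra G V \<phi>"
    and fib: "\<And>b. b \<in> V \<Longrightarrow> P (fiber G \<phi> b)"
    and empty: "P {}"
    and compl: "\<And>A. A \<in> fiber_algebra G V \<phi> \<Longrightarrow> P A \<Longrightarrow> P (carrier G - A)"
    and Un: "\<And>A B. A \<in> fiber_algebra G V \<phi> \<Longrightarrow> B \<in> fiber_algebra G V \<phi> \<Longrightarrow>
      P A \<Longrightarrow> P B \<Longrightarrow> P (A \<union> B)"
  shows "P A"
proof -
  interpret B: algebra "carrier G" "fiber_algebra G V \<phi>" by (rule algebra_fiber_algebra)
  have "algebra (carrier G) {A \<in> fiber_algebra G V \<phi>. P A}"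
    using empty compl Un B.compl_sets B.Un B.empty_sets B.space_closed
    by (auto simp: algebra_iff_Un)
  moreover have "fiber G \<phi> ` V \<subseteq> {A \<in> fiber_algebra G V \<phi>. P A}"
    using fib fiber_in_fiber_algebra by auto
  ultimately have "fiber_algebra G V \<phi> \<subseteq> {A \<in> fiber_algebra G V \<phi>. P A}"
    unfolding fiber_algebra_def by (rule hull_minimal[rotated])
  then show ?thesis using A by blast
qed

section \<open>Left translation and stability of the members of the algebra\<close>

lemma (in group) mem_l_coset_iff:
  assumes "A \<subseteq> carrier G" "g \<in> carrier G"
  shows "y \<in> g <# A \<longleftrightarrow> y \<in> carrier G \<and> inv g \<otimes> y \<in> A"
proof
  assume "y \<in> g <# A"
  then obtain a where "a \<in> A" "y = g \<otimes> a" by (auto simp: l_coset_def)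
  then show "y \<in> carrier G \<and> inv g \<otimes> y \<in> A"
    using assms by (auto simp: subsetD m_assoc[symmetric])
next
  assume y: "y \<in> carrier G \<and> inv g \<otimes> y \<in> A"
  then have "y = g \<otimes> (inv g \<otimes> y)" using assms by (simp add: m_assoc[symmetric])
  then show "y \<in> g <# A" using y unfolding l_coset_def by blast
qed

lemma left_invariant_fiber_algebra:
  fixes G (structure)
  assumes "group G" and inv: "left_invariant_rel G V \<phi>"
  shows "left_invariant_algebra G (fiber_algebra G V \<phi>)"
proof -
  interpret group G by fact
  interpret B: algebra "carrier G" "fiber_algebra G V \<phi>" by (rule algebra_fiber_algebra)
  have "g <# A \<in> fiber_algebra G V \<phi>" if g: "g \<in> carrier G" and "A \<in> fiber_algebra G V \<phi>" for g A
    using that(2)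
  proof (induction rule: fiber_algebra_induct)
    case (fiber b)
    then obtain c where "c \<in> V" "g <# fiber G \<phi> b = fiber G \<phi> c"
      using inv g unfolding left_invariant_rel_def by blast
    then show ?case by (simp add: fiber_in_fiber_algebra)
  next
    case empty
    then show ?case by (simp add: l_coset_def)
  next
    case (compl A)
    have A: "A \<subseteq> carrier G" using compl.hyps B.space_closed by blast
    have "g <# (carrier G - A) = carrier G - (g <# A)"
      using g A by (auto simp: mem_l_coset_iff)
    then show ?case using compl.IH by auto
  next
    case (Un A B)
    have "g <# (A \<union> B) = (g <# A) \<union> (g <# B)" by (auto simp: l_coset_def)
    then show ?case using Un.IH by auto
  qed
  then show ?thesis using B.algebra_axioms by (simp add: left_invariant_algebra_def)
qed

text \<open>The product of \<open>x\<close> and \<open>y\<close> lies in a fiber iff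
  \<open>y\<close> lies in its translate by the inverse of \<open>x\<close>, which is again a fiber,
  with parameter \<open>c x\<close>. The relation is thus \<open>\<phi>\<close> with its arguments
  swapped and one of them reparametrised.\<close>

lemma stable_in_fiber:
  fixes G (structure)
  assumes "group G" and inv: "left_invariant_rel G V \<phi>"
    and st: "stable_rel (carrier G) V \<phi>" and b: "b \<in> V"
  shows "stable_in G (fiber G \<phi> b)"
proof -
  interpret group G by fact
  have "\<forall>x\<in>carrier G. \<exists>c. c \<in> V \<and> inv x <# fiber G \<phi> b = fiber G \<phi> c"
    using inv b unfolding left_invariant_rel_def by blast
  from bchoice[OF this] obtain c where cV: "c \<in> carrier G \<rightarrow> V"
    and c: "\<And>x. x \<in> carrier G \<Longrightarrow> inv x <# fiber G \<phi> b = fiber G \<phi> (c x)"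
    by blast
  have eq: "x \<otimes> y \<in> fiber G \<phi> b \<longleftrightarrow> \<phi> y (c x)" if "x \<in> carrier G" "y \<in> carrier G" for x y
  proof -
    have "fiber G \<phi> b \<subseteq> carrier G" by (auto simp: fiber_def)
    then have "x \<otimes> y \<in> fiber G \<phi> b \<longleftrightarrow> y \<in> inv x <# fiber G \<phi> b"
      using that by (simp add: mem_l_coset_iff)
    also have "\<dots> \<longleftrightarrow> \<phi> y (c x)" using c that by (simp add: fiber_def)
    finally show ?thesis .
  qed
  show ?thesis
    unfolding stable_in_def
    by (rule stable_rel_reparam[OF stable_rel_swap[OF st] cV, where v = "\<lambda>y. y"]) (auto simp: eq)
qed

lemma stable_in_fiber_algebra:
  assumes "group G" and "left_invariant_rel G V \<phi>"
    and "stable_rel (carrier G) V \<phi>" and "A \<in> fiber_algebra G V \<phi>"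
  shows "stable_in G A"
  using assms(4)
proof (induction rule: fiber_algebra_induct)
  case (fiber b)
  then show ?case using assms(1-3) by (simp add: stable_in_fiber)
next
  case empty
  have "stable_rel (carrier G) (carrier G) (\<lambda>x y. False)"
    unfolding stable_rel_iff_subseq by (auto intro!: exI[of _ id] simp: strict_mono_def)
  then show ?case by (simp add: stable_in_def)
next
  case (compl A)
  interpret group G by fact
  \<comment> \<open>Complement in the carrier agrees with negation only at products of elements of
    \<open>G\<close>; reparametrising by identity maps restricts to these.\<close>
  show ?case
    unfolding stable_in_def
    by (rule stable_rel_reparam[where u = "\<lambda>x. x" and v = "\<lambda>y. y",
          OF stable_rel_combine[where h = "\<lambda>p q. \<not> p", OF compl.IH[unfolded stable_in_def]
            compl.IH[unfolded stable_in_def]]]) auto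
next
  case (Un A B)
  then show ?case
    using stable_rel_combine[where h = "(\<or>)"] unfolding stable_in_def Un_iff by blast
qed

section \<open>Sets that no fiber splits\<close>

text \<open>A state \<open>s\<close> records the elements \<open>U s\<close> and parameters
  \<open>D s\<close> still allowed. Iterating \<open>step\<close> yields an array with value
  \<open>d\<close> below the diagonal and the other value above it, which stability forbids.\<close>

lemma stable_rel_no_chain:
  fixes U :: "'s \<Rightarrow> 'a set" and D :: "'s \<Rightarrow> 'b set"
  assumes st: "stable_rel X Y \<phi>"
    and sub: "\<And>s. T s \<Longrightarrow> U s \<subseteq> X \<and> D s \<subseteq> Y"
    and start: "T s\<^sub>0"
    and step: "\<And>s. T s \<Longrightarrow> \<exists>s' b q. T s' \<and> U s' \<subseteq> U s \<and> D s' \<subseteq> D s \<and> b \<in> D s \<and> q \<in> U s \<and>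
      \<phi> q b = d \<and> (\<forall>x\<in>U s'. \<phi> x b = d) \<and> (\<forall>c\<in>D s'. \<phi> q c \<noteq> d)"
  shows False
proof -
  obtain nx bb qq where nx: "\<And>s. T s \<Longrightarrow> T (nx s) \<and> U (nx s) \<subseteq> U s \<and> D (nx s) \<subseteq> D s \<and>
      bb s \<in> D s \<and> qq s \<in> U s \<and> \<phi> (qq s) (bb s) = d \<and>
      (\<forall>x\<in>U (nx s). \<phi> x (bb s) = d) \<and> (\<forall>c\<in>D (nx s). \<phi> (qq s) c \<noteq> d)"
    using step by metis
  define s where "s n = (nx ^^ n) s\<^sub>0" for n
  have Ts: "T (s n)" for n
    by (induction n) (use start nx in \<open>auto simp: s_def\<close>)
  have s: "U (s (Suc n)) \<subseteq> U (s n)" "D (s (Suc n)) \<subseteq> D (s n)"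
      "bb (s n) \<in> D (s n)" "qq (s n) \<in> U (s n)"
      "\<forall>x\<in>U (s (Suc n)). \<phi> x (bb (s n)) = d" "\<forall>c\<in>D (s (Suc n)). \<phi> (qq (s n)) c \<noteq> d" for n
    using nx[OF Ts[of n]] by (auto simp: s_def)
  have mono: "U (s j) \<subseteq> U (s i)" "D (s j) \<subseteq> D (s i)" if "i \<le> j" for i j
    using lift_Suc_antimono_le[of "\<lambda>n. U (s n)", OF s(1) that]
      lift_Suc_antimono_le[of "\<lambda>n. D (s n)", OF s(2) that] by auto
  have below: "\<phi> (qq (s j)) (bb (s i)) = d" if "i < j" for i j
  proof -
    have "qq (s j) \<in> U (s (Suc i))" using s(4)[of j] mono(1)[of "Suc i" j] that by auto
    then show ?thesis using s(5) by blast
  qed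
  have above: "\<phi> (qq (s i)) (bb (s j)) \<noteq> d" if "i < j" for i j
  proof -
    have "bb (s j) \<in> D (s (Suc i))" using s(3)[of j] mono(2)[of "Suc i" j] that by auto
    then show ?thesis using s(6) by blast
  qed
  have "range (\<lambda>n. qq (s n)) \<subseteq> X" "range (\<lambda>n. bb (s n)) \<subseteq> Y"
    using sub[OF Ts] s(3,4) by blast+
  from stable_rel_subseq[OF st this] obtain f e where f: "strict_mono (f :: nat \<Rightarrow> nat)"
    and e: "\<forall>i j. i \<noteq> j \<longrightarrow> \<phi> (qq (s (f i))) (bb (s (f j))) = e"
    by (elim exE conjE)
  have "f 0 < f 1" using f by (simp add: strict_mono_less)
  from above[OF this] below[OF this] show False using e[rule_format, of 0 1] e[rule_format, of 1 0] by simp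
qed

text \<open>If every positive set were split by some fiber, one could build an infinite half graph. The
  difficulty is to control \<open>\<phi> (q i) (b j)\<close> for \<open>i < j\<close>, where \<open>b j\<close> is only known to split the
  current set. Either one may insist on the value \<open>True\<close> for all splitters to come, or from some
  point on every element of the current set can be made to force the value \<open>False\<close>; in both cases
  the remaining half of the array is given the opposite value.\<close>

lemma stable_rel_unsplit:
  assumes st: "stable_rel X Y \<phi>" and X: "pos X"
    and pos: "\<And>A. pos A \<Longrightarrow> A \<subseteq> X \<and> A \<noteq> {}"
    and up: "\<And>A B. pos A \<Longrightarrow> A \<subseteq> B \<Longrightarrow> B \<subseteq> X \<Longrightarrow> pos B"
  shows "\<exists>A. pos A \<and> (\<forall>b\<in>Y. \<not> (pos {x \<in> A. \<phi> x b} \<and> pos {x \<in> A. \<not> \<phi> x b}))"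
proof (rule ccontr)
  assume neg: "\<not> ?thesis"
  \<comment> \<open>The splitters of \<open>A\<close>; by \<open>neg\<close>, every positive set has
    one.\<close>
  define S where "S A = {b \<in> Y. pos {x \<in> A. \<phi> x b} \<and> pos {x \<in> A. \<not> \<phi> x b}}" for A
  have S_mono: "S A \<subseteq> S B" if "A \<subseteq> B" "B \<subseteq> X" for A B
  proof
    fix b assume b: "b \<in> S A"
    have "pos {x \<in> B. \<phi> x b}" by (rule up[of "{x \<in> A. \<phi> x b}"]) (use b that in \<open>auto simp: S_def\<close>)
    moreover have "pos {x \<in> B. \<not> \<phi> x b}"
      by (rule up[of "{x \<in> A. \<not> \<phi> x b}"]) (use b that in \<open>auto simp: S_def\<close>)
    ultimately show "b \<in> S B" using b by (simp add: S_def)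
  qed
  have S_ne: "S A \<noteq> {}" if "pos A" for A using neg that by (auto simp: S_def)
  \<comment> \<open>Goodness says that splitters of positive subsets of \<open>U\<close> can always
    be taken from \<open>C\<close>, so the parameters may be confined to \<open>C\<close>.\<close>
  define good where
    "good U C \<longleftrightarrow> pos U \<and> C \<subseteq> Y \<and> (\<forall>A\<subseteq>U. pos A \<longrightarrow> S A \<inter> C \<noteq> {})" for U C
  have good_mono: "good W C" if "good U C" "W \<subseteq> U" "pos W" for U W C
    using that unfolding good_def by (meson order_trans)
  have good_split: "\<exists>b. b \<in> S A \<and> b \<in> C" if "good U C" "A \<subseteq> U" "pos A" for U A C
    using that unfolding good_def by (meson IntE equals0I)
  \<comment> \<open>Density says that any positive subset of \<open>W\<close> can be shrunk so that
    \<open>q\<close> has value \<open>False\<close> at all its splitters in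
    \<open>C\<close>.\<close>
  define dense where
    "dense C W q \<longleftrightarrow> (\<forall>A\<subseteq>W. pos A \<longrightarrow> (\<exists>A'\<subseteq>A. pos A' \<and> (\<forall>b\<in>S A' \<inter> C. \<not> \<phi> q b)))" for C W q
  show False
  proof (cases "\<exists>W C. good W C \<and> (\<forall>q\<in>W. dense C W q)")
    case True
    then obtain W C where good: "good W C" and W: "\<forall>q\<in>W. dense C W q"
      by (elim exE conjE)
    show False
    \<comment> \<open>\<open>C\<close> stays fixed. Each step keeps the half of \<open>U\<close>
      where a splitter \<open>b\<close> is true, picks \<open>q\<close> there, and shrinks by
      density until \<open>q\<close> rejects all later splitters.\<close>
    proof (rule stable_rel_no_chain[OF st, where T = "\<lambda>U. U \<subseteq> W \<and> pos U" and U = "\<lambda>U. U"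
          and D = "\<lambda>U. S U \<inter> C" and d = True and s\<^sub>0 = W])
      show "U \<subseteq> X \<and> S U \<inter> C \<subseteq> Y" if "U \<subseteq> W \<and> pos U" for U
        using that pos by (auto simp: S_def)
      show "W \<subseteq> W \<and> pos W" using good by (simp add: good_def)
      fix U assume U: "U \<subseteq> W \<and> pos U"
      then obtain b where b: "b \<in> S U \<inter> C" using good_split[OF good, of U] by auto
      let ?A = "{x \<in> U. \<phi> x b}"
      have A: "pos ?A" using b by (simp add: S_def)
      then obtain q where q: "q \<in> ?A" using pos by blast
      obtain A' where A': "A' \<subseteq> ?A" "pos A'" "\<forall>b\<in>S A' \<inter> C. \<not> \<phi> q b"
      proof -
        have "dense C W q" using W q U by blast
        moreover have "?A \<subseteq> W" using U by blast
        ultimately show ?thesis using A that unfolding dense_def by meson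
      qed
      have "S A' \<subseteq> S U" using A'(1) U pos by (intro S_mono) auto
      then show "\<exists>U' b q. (U' \<subseteq> W \<and> pos U') \<and> U' \<subseteq> U \<and> S U' \<inter> C \<subseteq> S U \<inter> C \<and> b \<in> S U \<inter> C \<and> q \<in> U \<and>
          \<phi> q b = True \<and> (\<forall>x\<in>U'. \<phi> x b = True) \<and> (\<forall>c\<in>S U' \<inter> C. \<phi> q c \<noteq> True)"
        using A' U b q by (intro exI[of _ A'] exI[of _ b] exI[of _ q]) blast
    qed
  next
    case False
    \<comment> \<open>Failure of density at \<open>q\<close> gives a positive \<open>A\<close> all
      of whose positive subsets have splitters in \<open>C\<close> accepted by \<open>q\<close>, so
      \<open>C\<close> may be cut down to those.\<close>
    have next_good: "\<exists>q\<in>W. \<exists>A\<subseteq>W. good A {b \<in> C. \<phi> q b}" if WC: "good W C" for W C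
    proof -
      obtain q where q: "q \<in> W" "\<not> dense C W q" using False WC by meson
      then obtain A where A: "A \<subseteq> W" "pos A"
        and ex: "\<And>A'. A' \<subseteq> A \<Longrightarrow> pos A' \<Longrightarrow> \<exists>b\<in>S A' \<inter> C. \<phi> q b"
        unfolding dense_def by meson
      have "S A' \<inter> {b \<in> C. \<phi> q b} \<noteq> {}" if "A' \<subseteq> A" "pos A'" for A'
        using ex[OF that] by auto
      moreover have "{b \<in> C. \<phi> q b} \<subseteq> Y" using \<open>good W C\<close> by (auto simp: good_def)
      ultimately have "good A {b \<in> C. \<phi> q b}" using A(2) by (simp add: good_def)
      then show ?thesis using q A(1) by auto
    qed
    show False
    proof (rule stable_rel_no_chain[OF st, where T = "\<lambda>(U, C). good U C" and U = fst
          and D = snd and d = False and s\<^sub>0 = "(X, Y)"])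
      show "fst s \<subseteq> X \<and> snd s \<subseteq> Y" if "case s of (U, C) \<Rightarrow> good U C" for s
        using that pos[of "fst s"] by (cases s) (simp add: good_def)
      have "S A \<inter> Y \<noteq> {}" if "pos A" for A using S_ne[OF that] by (auto simp: S_def)
      then show "case (X, Y) of (U, C) \<Rightarrow> good U C" using X by (simp add: good_def)
      fix s :: "'a set \<times> 'b set" assume s: "case s of (U, C) \<Rightarrow> good U C"
      obtain U C where sUC: "s = (U, C)" by (cases s)
      then have good: "good U C" using s by simp
      then have "pos U" by (simp add: good_def)
      with good_split[OF good] obtain b where b: "b \<in> S U" "b \<in> C" by blast
      let ?A = "{x \<in> U. \<not> \<phi> x b}"
      \<comment> \<open>The half where \<open>b\<close> is false is kept first, so that
        \<open>q\<close>, chosen inside it, also has value \<open>False\<close> at \<open>b\<close>;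
        later parameters then get the value \<open>True\<close> at \<open>q\<close>.\<close>
      have "good ?A C" using b by (intro good_mono[OF good]) (auto simp: S_def)
      from next_good[OF this] obtain q A where q: "q \<in> ?A" and A: "A \<subseteq> ?A" "good A {b \<in> C. \<phi> q b}"
        by blast
      show "\<exists>s' b q. (case s' of (U, C) \<Rightarrow> good U C) \<and> fst s' \<subseteq> fst s \<and> snd s' \<subseteq> snd s \<and>
          b \<in> snd s \<and> q \<in> fst s \<and> \<phi> q b = False \<and> (\<forall>x\<in>fst s'. \<phi> x b = False) \<and>
          (\<forall>c\<in>snd s'. \<phi> q c \<noteq> False)"
        using A b q
        by (intro exI[of _ "(A, {b \<in> C. \<phi> q b})"] exI[of _ b] exI[of _ q]) (auto simp: sUC)
    qed
  qed
qed

section \<open>Left-invariant ideals and the index of subgroups\<close>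

text \<open>The ideal consists of arbitrary subsets of the group, not only members of the fiber
  algebra, since the unsplit set \<open>A\<close> found later need not belong to that
  algebra.\<close>

definition left_invariant_ideal :: "('a, 'm) monoid_scheme \<Rightarrow> 'a set set \<Rightarrow> bool" where
  "left_invariant_ideal G J \<longleftrightarrow> J \<subseteq> Pow (carrier G) \<and> {} \<in> J \<and> carrier G \<notin> J \<and>
    (\<forall>A\<in>J. \<forall>B. B \<subseteq> A \<longrightarrow> B \<in> J) \<and> (\<forall>A\<in>J. \<forall>B\<in>J. A \<union> B \<in> J) \<and>
    (\<forall>g\<in>carrier G. \<forall>A\<in>J. g <#\<^bsub>G\<^esub> A \<in> J)"

lemma left_invariant_idealD:
  assumes "left_invariant_ideal G J"
  shows "A \<in> J \<Longrightarrow> A \<subseteq> carrier G" "{} \<in> J" "carrier G \<notin> J"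
    "A \<in> J \<Longrightarrow> B \<subseteq> A \<Longrightarrow> B \<in> J" "A \<in> J \<Longrightarrow> B \<in> J \<Longrightarrow> A \<union> B \<in> J"
    "g \<in> carrier G \<Longrightarrow> A \<in> J \<Longrightarrow> g <#\<^bsub>G\<^esub> A \<in> J"
  using assms unfolding left_invariant_ideal_def by blast+

lemma left_invariant_ideal_UN:
  assumes J: "left_invariant_ideal G J" and "finite F" and "\<And>x. x \<in> F \<Longrightarrow> A x \<in> J"
  shows "(\<Union>x\<in>F. A x) \<in> J"
  using assms(2,3)
  by (induction F) (auto intro: left_invariant_idealD(2,5)[OF J])

text \<open>Zorn's lemma, starting from the ideal \<open>{{}}\<close>. Comparability in the chain is
  what closes its union under binary unions.\<close>

lemma maximal_left_invariant_ideal: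
  fixes G (structure)
  assumes "group G"
  obtains J where "left_invariant_ideal G J"
    "\<And>K. left_invariant_ideal G K \<Longrightarrow> J \<subseteq> K \<Longrightarrow> K = J"
proof -
  interpret group G by fact
  have "carrier G \<noteq> {}" using one_closed by blast
  then have "left_invariant_ideal G {{}}"
    by (simp add: left_invariant_ideal_def l_coset_def)
  then have ne: "{J. left_invariant_ideal G J} \<noteq> {}" by blast
  have "\<Union>\<C> \<in> {J. left_invariant_ideal G J}"
    if ne: "\<C> \<noteq> {}" and chain: "subset.chain {J. left_invariant_ideal G J} \<C>" for \<C>
  proof -
    have id: "left_invariant_ideal G J" if "J \<in> \<C>" for J
      using chain that by (auto simp: subset.chain_def)
    note idD = left_invariant_idealD[OF id]
    have Un: "A \<union> B \<in> \<Union>\<C>" if AB: "A \<in> \<Union>\<C>" "B \<in> \<Union>\<C>" for A B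
    proof -
      obtain J K where J: "J \<in> \<C>" "A \<in> J" and K: "K \<in> \<C>" "B \<in> K" using AB by blast
      have "J \<subseteq> K \<or> K \<subseteq> J" using chain J(1) K(1) unfolding subset_chain_def by blast
      then show ?thesis
      proof
        assume "J \<subseteq> K"
        then have "A \<union> B \<in> K" using J K idD(5) by blast
        then show ?thesis using K(1) by blast
      next
        assume "K \<subseteq> J"
        then have "A \<union> B \<in> J" using J K idD(5) by blast
        then show ?thesis using J(1) by blast
      qed
    qed
    have "left_invariant_ideal G (\<Union>\<C>)"
      unfolding left_invariant_ideal_def
    proof (intro conjI ballI allI impI)
      show "\<Union>\<C> \<subseteq> Pow (carrier G)" using idD(1) by blast
      show "{} \<in> \<Union>\<C>" using ne idD(2) by blast
      show "carrier G \<notin> \<Union>\<C>" using idD(3) by blast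
    next
      fix A B assume "A \<in> \<Union>\<C>" "B \<subseteq> A"
      then show "B \<in> \<Union>\<C>" using idD(4) by blast
    next
      fix g A assume "g \<in> carrier G" "A \<in> \<Union>\<C>"
      then show "g <# A \<in> \<Union>\<C>" using idD(6) by blast
    qed (rule Un)
    then show ?thesis by simp
  qed
  from subset_Zorn_nonempty[OF ne this] show thesis using that by blast
qed

text \<open>Otherwise \<open>A\<close> and \<open>J\<close> would generate a larger proper ideal.\<close>

lemma maximal_left_invariant_ideal_cover:
  fixes G (structure)
  assumes "group G" and J: "left_invariant_ideal G J"
    and max: "\<And>K. left_invariant_ideal G K \<Longrightarrow> J \<subseteq> K \<Longrightarrow> K = J"
    and A: "A \<subseteq> carrier G" "A \<notin> J"
  obtains F where "finite F" "F \<subseteq> carrier G" "carrier G - (\<Union>g\<in>F. g <# A) \<in> J"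
proof (rule ccontr)
  assume neg: "\<not> thesis"
  interpret group G by fact
  note JD = left_invariant_idealD[OF J]
  define T where "T F = (\<Union>g\<in>F. g <# A)" for F
  \<comment> \<open>\<open>K\<close> is the ideal of sets covered modulo \<open>J\<close> by
    finitely many translates of \<open>A\<close>; it is proper exactly when the desired cover does
    not exist.\<close>
  define K where
    "K = {B. B \<subseteq> carrier G \<and> (\<exists>F. finite F \<and> F \<subseteq> carrier G \<and> B - T F \<in> J)}"
  have K: "B \<in> K" if "B \<subseteq> carrier G" "finite F" "F \<subseteq> carrier G" "B - T F \<in> J" for B F
    using that unfolding K_def by blast
  have KE: "\<exists>F. B \<subseteq> carrier G \<and> finite F \<and> F \<subseteq> carrier G \<and> B - T F \<in> J" if "B \<in> K" for B
    using that unfolding K_def by blast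
  have JK: "J \<subseteq> K"
  proof
    fix B assume "B \<in> J"
    then show "B \<in> K" using JD(1) by (intro K[of B "{}"]) (auto simp: T_def)
  qed
  have A1: "A - T {\<one>} = {}" using A(1) by (auto simp: T_def mem_l_coset_iff subsetD)
  then have AK: "A \<in> K" by (intro K[of A "{\<one>}"]) (unfold A1, use A(1) JD(2) in auto)
  have "left_invariant_ideal G K"
    unfolding left_invariant_ideal_def
  proof (intro conjI ballI allI impI)
    show "K \<subseteq> Pow (carrier G)" by (auto simp: K_def)
    show "{} \<in> K" using JK JD(2) by blast
    show "carrier G \<notin> K"
    proof
      assume "carrier G \<in> K"
      then obtain F where "finite F" "F \<subseteq> carrier G" "carrier G - T F \<in> J" using KE by meson
      then show False using neg that unfolding T_def by blast
    qed
  next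
    fix B C assume "B \<in> K" "C \<subseteq> B"
    then obtain F where F: "B \<subseteq> carrier G" "finite F" "F \<subseteq> carrier G" "B - T F \<in> J"
      using KE by meson
    have "C - T F \<in> J" by (rule JD(4)[OF F(4)]) (use \<open>C \<subseteq> B\<close> in auto)
    then show "C \<in> K" using F \<open>C \<subseteq> B\<close> by (intro K[of C F]) auto
  next
    fix B C assume "B \<in> K" "C \<in> K"
    then obtain F F' where F: "B \<subseteq> carrier G" "finite F" "F \<subseteq> carrier G" "B - T F \<in> J"
      and F': "C \<subseteq> carrier G" "finite F'" "F' \<subseteq> carrier G" "C - T F' \<in> J"
      using KE by meson
    have "B \<union> C - T (F \<union> F') \<in> J"
      by (rule JD(4)[OF JD(5)[OF F(4) F'(4)]]) (auto simp: T_def)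
    then show "B \<union> C \<in> K" using F F' by (intro K[of _ "F \<union> F'"]) auto
  next
    fix h B assume h: "h \<in> carrier G" and "B \<in> K"
    then obtain F where F: "B \<subseteq> carrier G" "finite F" "F \<subseteq> carrier G" "B - T F \<in> J"
      using KE by meson
    \<comment> \<open>Translating a cover by \<open>h\<close> multiplies its index set
      \<open>F\<close> by \<open>h\<close> on the left.\<close>
    have "(h <# B) - T ((\<otimes>) h ` F) \<subseteq> h <# (B - T F)"
    proof
      fix y assume y: "y \<in> (h <# B) - T ((\<otimes>) h ` F)"
      then have "y \<in> carrier G" "inv h \<otimes> y \<in> B" using h F(1) by (auto simp: mem_l_coset_iff)
      moreover have "inv h \<otimes> y \<notin> T F"
      proof
        assume "inv h \<otimes> y \<in> T F"
        then obtain g where g: "g \<in> F" "inv h \<otimes> y \<in> g <# A" by (auto simp: T_def)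
        then have "inv (h \<otimes> g) \<otimes> y \<in> A"
          using h F(3) A(1) \<open>y \<in> carrier G\<close>
          by (auto simp: mem_l_coset_iff inv_mult_group m_assoc subsetD)
        then have "y \<in> (h \<otimes> g) <# A"
          using h g(1) F(3) A(1) \<open>y \<in> carrier G\<close> by (simp add: mem_l_coset_iff subsetD)
        then show False using y g(1) by (auto simp: T_def)
      qed
      ultimately show "y \<in> h <# (B - T F)" using h F(1) by (subst mem_l_coset_iff) auto
    qed
    then have "(h <# B) - T ((\<otimes>) h ` F) \<in> J" using JD(6)[OF h F(4)] JD(4) by blast
    moreover have "h <# B \<subseteq> carrier G" using h F(1) by (auto simp: mem_l_coset_iff)
    ultimately show "h <# B \<in> K"
      using h F by (intro K[of _ "(\<otimes>) h ` F"]) auto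
  qed
  then have "K = J" using JK by (rule max)
  then show False using AK A(2) by simp
qed

text \<open>Modulo \<open>J\<close>, each translate of \<open>A\<close> lies in a single left coset of \<open>H\<close>, and the translates by
  \<open>F\<close> meet all left cosets. The left cosets are indexed below by the right cosets \<open>C = H r\<close>, as
  \<open>D C = r\<^sup>-\<^sup>1 H\<close>.\<close>

lemma card_rcosets_le:
  fixes G (structure)
  assumes "group G" and J: "left_invariant_ideal G J" and \<B>: "left_invariant_algebra G \<B>"
    and A: "A \<subseteq> carrier G"
    and unsplit: "\<And>D. D \<in> \<B> \<Longrightarrow> A \<inter> D \<in> J \<or> A - D \<in> J"
    and F: "finite F" "F \<subseteq> carrier G" and cover: "carrier G - (\<Union>g\<in>F. g <# A) \<in> J"
    and H: "H \<in> \<B>" "subgroup H G" "finite (rcosets H)"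
  shows "card (rcosets H) \<le> card F"
proof -
  interpret group G by fact
  interpret H: subgroup H G by fact
  note JD = left_invariant_idealD[OF J]
  have \<B>l: "g <# D \<in> \<B>" if "g \<in> carrier G" "D \<in> \<B>" for g D
    using \<B> that by (simp add: left_invariant_algebra_def)
  have "\<forall>C\<in>rcosets H. \<exists>r. r \<in> carrier G \<and> C = H #> r" by (auto simp: RCOSETS_def)
  from bchoice[OF this] obtain r
    where r: "\<And>C. C \<in> rcosets H \<Longrightarrow> r C \<in> carrier G \<and> C = H #> r C" by blast
  \<comment> \<open>The index counts right cosets, while \<open>\<B>\<close> is closed under left
    translation; inversion matches the two kinds of coset.\<close>
  define D where "D C = inv (r C) <# H" for C
  have mem_D: "y \<in> D C \<longleftrightarrow> y \<in> carrier G \<and> r C \<otimes> y \<in> H" if "C \<in> rcosets H" for C y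
    using r[OF that] H.subset by (simp add: D_def mem_l_coset_iff)
  have D_\<B>: "D C \<in> \<B>" if "C \<in> rcosets H" for C
    using r[OF that] H(1) by (simp add: D_def \<B>l)
  \<comment> \<open>In the quotient of the two elements of \<open>H\<close> the common
    \<open>y\<close> cancels, so both representatives lie in one right coset.\<close>
  have eq: "C = C'" if C: "C \<in> rcosets H" "C' \<in> rcosets H" and y: "y \<in> D C" "y \<in> D C'" for C C' y
  proof -
    have r': "r C \<in> carrier G" "r C' \<in> carrier G" "y \<in> carrier G"
      using r C y(1) mem_D by auto
    have "r C \<otimes> y \<in> H" "r C' \<otimes> y \<in> H" using mem_D C y by auto
    then have "(r C \<otimes> y) \<otimes> inv (r C' \<otimes> y) \<in> H" by blast
    also have "(r C \<otimes> y) \<otimes> inv (r C' \<otimes> y) = r C \<otimes> (y \<otimes> (inv y \<otimes> inv (r C')))"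
      using r' by (simp add: inv_mult_group m_assoc)
    also have "y \<otimes> (inv y \<otimes> inv (r C')) = inv (r C')"
      using r' by (simp add: m_assoc[symmetric])
    finally have "r C \<otimes> inv (r C') \<in> H" .
    then have "r C \<in> H #> r C'"
      using r' by (auto simp: r_coset_def m_assoc intro!: bexI[of _ "r C \<otimes> inv (r C')"])
    then have "H #> r C' = H #> r C" using r' H(2) repr_independence by blast
    then show "C = C'" using r C by metis
  qed
  have covers: "carrier G \<subseteq> (\<Union>C\<in>rcosets H. D C)"
  proof
    fix y assume y: "y \<in> carrier G"
    define C where "C = H #> inv y"
    have C: "C \<in> rcosets H" using y by (auto simp: C_def RCOSETS_def)
    have "inv y \<in> C" using y H(2) by (simp add: C_def rcos_self)
    then have "inv y \<in> H #> r C" using r[OF C] by simp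
    then obtain h where h: "h \<in> H" "inv y = h \<otimes> r C" by (auto simp: r_coset_def)
    have "r C \<otimes> y = inv h \<otimes> (h \<otimes> r C) \<otimes> y"
      using h(1) r[OF C] y by (simp add: m_assoc[symmetric])
    also have "\<dots> = inv h" using h y by (simp flip: h(2) add: m_assoc)
    finally have "r C \<otimes> y \<in> H" using h(1) by simp
    then show "y \<in> (\<Union>C\<in>rcosets H. D C)" using C y mem_D by auto
  qed
  \<comment> \<open>One left coset in \<open>J\<close> would put all of them there by invariance,
    and with finite index their union, the whole group.\<close>
  have D_pos: "D C \<notin> J" if C: "C \<in> rcosets H" for C
  proof
    assume "D C \<in> J"
    then have "r C <# D C \<in> J" using r[OF C] JD(6) by blast
    moreover have "r C <# D C = H"
      using r[OF C] H.subset by (simp add: D_def lcos_m_assoc lcos_mult_one)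
    ultimately have "H \<in> J" by simp
    then have "(\<Union>C\<in>rcosets H. D C) \<in> J"
      using r JD(6) by (intro left_invariant_ideal_UN[OF J H(3)]) (simp add: D_def)
    then show False using covers JD(3,4) by blast
  qed
  have "\<exists>g. g \<in> F \<and> (g <# A) \<inter> D C \<notin> J" if C: "C \<in> rcosets H" for C
  proof (rule ccontr)
    assume "\<not> ?thesis"
    then have "(\<Union>g\<in>F. (g <# A) \<inter> D C) \<in> J"
      by (intro left_invariant_ideal_UN[OF J F(1)]) auto
    from JD(5)[OF cover this] have "D C \<in> J" by (rule JD(4)) (use mem_D C in auto)
    then show False using D_pos C by simp
  qed
  then obtain \<gamma> where \<gamma>: "\<And>C. C \<in> rcosets H \<Longrightarrow> \<gamma> C \<in> F \<and> (\<gamma> C <# A) \<inter> D C \<notin> J"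
    using bchoice[of "rcosets H" "\<lambda>C g. g \<in> F \<and> (g <# A) \<inter> D C \<notin> J"] by blast
  \<comment> \<open>Translate back to \<open>A\<close>: the member \<open>?E\<close> of
    \<open>\<B>\<close> does not split \<open>A\<close>, and \<open>A \<inter> ?E\<close> is not in
    \<open>J\<close>, so \<open>A - ?E\<close> is.\<close>
  have inside: "(\<gamma> C <# A) - D C \<in> J" if C: "C \<in> rcosets H" for C
  proof -
    let ?g = "\<gamma> C"
    let ?E = "inv ?g <# D C"
    have g: "?g \<in> carrier G" using \<gamma>[OF C] F(2) by blast
    have D: "D C \<subseteq> carrier G" using mem_D C by blast
    have E: "y \<in> ?E \<longleftrightarrow> y \<in> carrier G \<and> ?g \<otimes> y \<in> D C" for y
      using g D by (simp add: mem_l_coset_iff)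
    have tr: "y \<in> ?g <# B \<longleftrightarrow> y \<in> carrier G \<and> inv ?g \<otimes> y \<in> B" if "B \<subseteq> A" for B y
      using that A g by (intro mem_l_coset_iff) auto
    have gg: "?g \<otimes> (inv ?g \<otimes> y) = y" if "y \<in> carrier G" for y
      using g that by (simp add: m_assoc[symmetric])
    have "?g <# (A \<inter> ?E) = (?g <# A) \<inter> D C" and minus: "?g <# (A - ?E) = (?g <# A) - D C"
      using g by (auto simp: tr E gg)
    then have "A \<inter> ?E \<notin> J" using \<gamma>[OF C] JD(6)[OF g, of "A \<inter> ?E"] by auto
    then have "A - ?E \<in> J" using unsplit[of ?E] \<B>l[of "inv ?g" "D C"] D_\<B>[OF C] g by auto
    then show ?thesis using JD(6)[OF g] minus by metis
  qed
  have "inj_on \<gamma> (rcosets H)"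
  proof (rule inj_onI, rule ccontr)
    fix C C' assume C: "C \<in> rcosets H" "C' \<in> rcosets H" "\<gamma> C = \<gamma> C'" "C \<noteq> C'"
    \<comment> \<open>A translate shared by two disjoint cosets would have its part in the second
      one negligible, against the choice of \<open>\<gamma>\<close>.\<close>
    have "(\<gamma> C' <# A) \<inter> D C' \<subseteq> (\<gamma> C <# A) - D C" using C eq by auto
    then show False using JD(4)[OF inside[OF C(1)]] \<gamma>[OF C(2)] by blast
  qed
  moreover have "\<gamma> ` (rcosets H) \<subseteq> F" using \<gamma> by blast
  ultimately show ?thesis using F(1) by (rule card_inj_on_le)
qed

section \<open>Comparison of finite-index subgroups and the smallest one\<close>

text \<open>A coset of the intersection is the intersection of a coset of \<open>H\<close> and one
  of \<open>K\<close>, so there are finitely many.\<close>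

lemma finite_index_subgroup_Int:
  fixes G (structure)
  assumes "group G" and "finite_index_subgroup H G" and "finite_index_subgroup K G"
  shows "finite_index_subgroup (H \<inter> K) G"
proof -
  interpret group G by fact
  have H: "subgroup H G" "finite (rcosets H)" and K: "subgroup K G" "finite (rcosets K)"
    using assms(2,3) by (auto simp: finite_index_subgroup_def)
  have "(H \<inter> K) #> a = (H #> a) \<inter> (K #> a)" if "a \<in> carrier G" for a
  proof -
    have "h = k" if "h \<in> H" "k \<in> K" "h \<otimes> a = k \<otimes> a" for h k
      using that \<open>a \<in> carrier G\<close> H(1) K(1) by (meson right_cancel subgroup.mem_carrier)
    then show ?thesis by (auto simp: r_coset_def)
  qed
  then have "rcosets (H \<inter> K) \<subseteq> (\<lambda>(C, D). C \<inter> D) ` ((rcosets H) \<times> (rcosets K))"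
    by (force simp: RCOSETS_def)
  then have "finite (rcosets (H \<inter> K))" using H(2) K(2) by (auto intro: finite_subset)
  then show ?thesis
    using H(1) K(1) by (simp add: finite_index_subgroup_def subgroups_Inter_pair)
qed

text \<open>Multiplying by \<open>H\<close> maps the cosets of \<open>L\<close> onto those of
  \<open>H\<close>. The cardinality bound makes this map injective, and for \<open>h\<close> in
  \<open>H\<close> it sends both \<open>L #> h\<close> and \<open>L\<close> to
  \<open>H\<close>.\<close>

lemma subgroup_eq_of_card_rcosets_le:
  fixes G (structure)
  assumes "group G" and L: "subgroup L G" "finite (rcosets L)" and H: "subgroup H G"
    and sub: "L \<subseteq> H" and le: "card (rcosets L) \<le> card (rcosets H)"
  shows "L = H"
proof -
  interpret group G by fact
  have sL: "L \<subseteq> carrier G" and sH: "H \<subseteq> carrier G" using L(1) H by (auto dest: subgroup.subset)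
  have HL: "H <#> L = H"
  proof
    show "H <#> L \<subseteq> H" using sub H by (auto simp: set_mult_def subgroup.m_closed)
    show "H \<subseteq> H <#> L"
    proof
      fix h assume "h \<in> H"
      then have "h = h \<otimes> \<one>" using sH by auto
      then show "h \<in> H <#> L" using \<open>h \<in> H\<close> subgroup.one_closed[OF L(1)] unfolding set_mult_def by blast
    qed
  qed
  have f: "H <#> (L #> a) = H #> a" if "a \<in> carrier G" for a
    using setmult_rcos_assoc[OF sH sL that] HL by simp
  have "(\<lambda>C. H <#> C) ` (rcosets L) = rcosets H"
    using f by (auto simp: RCOSETS_def image_UN)
  then have inj: "inj_on (\<lambda>C. H <#> C) (rcosets L)"
    using le L(2) by (metis card_image_le eq_card_imp_inj_on le_antisym)
  have "h \<in> L" if h: "h \<in> H" for h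
  proof -
    have hc: "h \<in> carrier G" using h sH by blast
    have "H <#> (L #> h) = H <#> (L #> \<one>)"
      using f[OF hc] f[OF one_closed] h hc H sH by (simp add: coset_join2)
    then have "L #> h = L #> \<one>"
      by (rule inj_onD[OF inj]) (use hc in \<open>auto simp: RCOSETS_def\<close>)
    then show "h \<in> L" using rcos_self[OF hc L(1)] sL by simp
  qed
  then show ?thesis using sub by blast
qed

text \<open>The bound is uniform because \<open>J\<close>, \<open>A\<close> and \<open>F\<close> are
  chosen before any subgroup is considered.\<close>

lemma fiber_algebra_index_bound:
  fixes G (structure)
  assumes "group G" and inv: "left_invariant_rel G V \<phi>"
    and st: "stable_rel (carrier G) V \<phi>"
  shows "\<exists>n. \<forall>H\<in>fiber_algebra G V \<phi>. finite_index_subgroup H G \<longrightarrow> card (rcosets H) \<le> n"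
proof -
  interpret group G by fact
  obtain J where J: "left_invariant_ideal G J"
    and max: "\<And>K. left_invariant_ideal G K \<Longrightarrow> J \<subseteq> K \<Longrightarrow> K = J"
    using maximal_left_invariant_ideal[OF \<open>group G\<close>] by blast
  note JD = left_invariant_idealD[OF J]
  \<comment> \<open>The positive sets are the subsets of the group outside \<open>J\<close>.\<close>
  have "\<exists>A. (A \<subseteq> carrier G \<and> A \<notin> J) \<and> (\<forall>b\<in>V. \<not> (({x \<in> A. \<phi> x b} \<subseteq> carrier G \<and> {x \<in> A. \<phi> x b} \<notin> J) \<and>
      ({x \<in> A. \<not> \<phi> x b} \<subseteq> carrier G \<and> {x \<in> A. \<not> \<phi> x b} \<notin> J)))"
    by (rule stable_rel_unsplit[OF st, where pos = "\<lambda>A. A \<subseteq> carrier G \<and> A \<notin> J"])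
      (use JD(2-4) in auto)
  then obtain A where A: "A \<subseteq> carrier G" "A \<notin> J"
    and fib: "\<And>b. b \<in> V \<Longrightarrow> {x \<in> A. \<phi> x b} \<in> J \<or> {x \<in> A. \<not> \<phi> x b} \<in> J"
    by blast
  obtain F where F: "finite F" "F \<subseteq> carrier G" "carrier G - (\<Union>g\<in>F. g <# A) \<in> J"
    using maximal_left_invariant_ideal_cover[OF \<open>group G\<close> J max A] by blast
  have unsplit: "A \<inter> D \<in> J \<or> A - D \<in> J" if "D \<in> fiber_algebra G V \<phi>" for D
    using that
  proof (induction rule: fiber_algebra_induct)
    case (fiber b)
    have "A \<inter> fiber G \<phi> b = {x \<in> A. \<phi> x b}" "A - fiber G \<phi> b = {x \<in> A. \<not> \<phi> x b}"
      using A(1) by (auto simp: fiber_def)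
    then show ?case using fib[OF fiber] by simp
  next
    case empty
    then show ?case using JD(2) by simp
  next
    case (compl D)
    have "A \<inter> (carrier G - D) = A - D" "A - (carrier G - D) = A \<inter> D" using A(1) by auto
    then show ?case using compl.IH by auto
  next
    case (Un D E)
    \<comment> \<open>Either both traces on \<open>A\<close> lie in \<open>J\<close>, and so does
      their union, or one of \<open>A - D\<close> and \<open>A - E\<close> lies in \<open>J\<close>
      and contains \<open>A - (D \<union> E)\<close>.\<close>
    have "A \<inter> (D \<union> E) = (A \<inter> D) \<union> (A \<inter> E)" "A - (D \<union> E) \<subseteq> A - D" "A - (D \<union> E) \<subseteq> A - E" by auto
    then show ?case using Un.IH JD(4,5) by metis
  qed
  have "card (rcosets H) \<le> card F"
    if "H \<in> fiber_algebra G V \<phi>" "finite_index_subgroup H G" for H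
    using that card_rcosets_le[OF \<open>group G\<close> J left_invariant_fiber_algebra[OF \<open>group G\<close> inv] A(1)
        unsplit F]
    by (simp add: finite_index_subgroup_def)
  then show ?thesis by blast
qed

theorem theorem5p8:
  fixes G :: "('a, 'm) monoid_scheme"
    and V :: "'b set"
    and \<phi> :: "'a \<Rightarrow> 'b \<Rightarrow> bool"
  assumes "group G"
    and "left_invariant_rel G V \<phi>"
    and "stable_rel (carrier G) V \<phi>"
  shows "left_invariant_algebra G (fiber_algebra G V \<phi>)
    \<and> (\<forall>A \<in> fiber_algebra G V \<phi>. stable_in G A)
    \<and> finite_index_subgroup (G_zero G (fiber_algebra G V \<phi>)) G
    \<and> (\<exists>H \<in> fiber_algebra G V \<phi>. finite_index_subgroup H G \<and>
         (\<forall>K \<in> fiber_algebra G V \<phi>. finite_index_subgroup K G \<longrightarrow> H \<subseteq> K))"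
proof -
  interpret group G by fact
  interpret B: algebra "carrier G" "fiber_algebra G V \<phi>" by (rule algebra_fiber_algebra)
  define P where "P H \<longleftrightarrow> H \<in> fiber_algebra G V \<phi> \<and> finite_index_subgroup H G" for H
  obtain n where n: "\<forall>H. P H \<longrightarrow> card (rcosets\<^bsub>G\<^esub> H) < n"
    using fiber_algebra_index_bound[OF assms] unfolding P_def by (meson le_imp_less_Suc)
  have "rcosets\<^bsub>G\<^esub> (carrier G) \<subseteq> {carrier G}"
    by (auto simp: RCOSETS_def coset_join2 subgroup_self)
  then have "finite (rcosets\<^bsub>G\<^esub> (carrier G))" by (rule finite_subset) simp
  \<comment> \<open>The whole group has index one, so there is a candidate and a bounded maximum
    exists.\<close>
  then have "P (carrier G)" by (simp add: P_def finite_index_subgroup_def subgroup_self B.top)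
  from ex_has_greatest_nat[of P, OF this n] obtain H
    where H: "P H" and max: "\<And>K. P K \<Longrightarrow> card (rcosets\<^bsub>G\<^esub> K) \<le> card (rcosets\<^bsub>G\<^esub> H)"
    by blast
  have least: "H \<subseteq> K" if "P K" for K
  proof -
    \<comment> \<open>By maximality this smaller subgroup has at most as many cosets as
      \<open>H\<close>, which forces it to equal \<open>H\<close>.\<close>
    have "P (H \<inter> K)"
      using H that finite_index_subgroup_Int[OF \<open>group G\<close>] by (auto simp: P_def)
    then have "H \<inter> K = H"
      using max H by (intro subgroup_eq_of_card_rcosets_le[OF \<open>group G\<close>])
        (auto simp: P_def finite_index_subgroup_def)
    then show ?thesis by blast
  qed
  have "G_zero G (fiber_algebra G V \<phi>) = H"
    unfolding G_zero_def using H least by (auto simp: P_def)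
  then show ?thesis
    using left_invariant_fiber_algebra[OF assms(1,2)] stable_in_fiber_algebra[OF assms] H least
    unfolding P_def by auto
qed

end
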